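(* Let $\mathcal{A}$ be a recursive algorithm enumerating a finite set $S$ and assume that $\mathcal{A}$ satisfies the Pyramid condition with time $T^\star$ (for some potential function). Let $\Delta$ be an upper bound on the total number of instructions executed by all iterations on any path in the recursion tree from the root to a leaf. Then for every $k$, $\mathcal{A}$ enumerates the first $k$ elements of $S$ in time $O(kT^\star + \Delta)$.
   Context: Setting (recursive enumeration algorithms): A recursive algorithm $\mathcal{A}$ enumerates ("visits") every element of a finite set $S$ exactly once. Its recursive calls form a recursion tree; an iteration is one execution of the recursive function, excluding the computation done inside the calls it makes recursively, and iterations are identified with nodes of the recursion tree. Each iteration is labeled by the set $X\subseteq S$ of elements visited by that iteration or any of its descendants. In iteration $X$ a partition $X = X_1 \,\dot\cup\, \cdots \,\dot\cup\, X_m \,\dot\cup\, X'$ with $X_1,\dots,X_m\neq\emptyset$ is formed, where $X'$ (possibly empty) is the set of elements visited directly by $X$, and the function is called recursively on $X_1,\dots,X_m$ (the children of $X$, forming $C(X)$). $T(X)$ denotes the number of instructions executed by iteration $X$ itself. A potential function $\Phi$ assigns a number $\Phi(X)>0$ to every iteration. Pyramid condition: $\mathcal{A}$ satisfies it with respect to $\Phi$ and time $T^\star>0$ if there is a constant $\mu>0$ such that for every iteration $X$, $\sum_{Y\in C(X)} \Phi(Y) + \mu |X'| - \Phi(X) \ge T(X)/T^\star$. *)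

theory Defs
  imports Complex_Main
begin

text \<open>
  A recursive algorithm enters only through its (terminating) execution. One iteration is the
  chronological list of what it does: execute a single instruction of its own, visit an element,
  or make a recursive call, whose whole execution takes place at that point. Work, visits and
  calls may be interleaved in any way. A visit is a marker that is not charged by itself; the
  instructions needed to perform it, or a call, are listed as \<open>Instr\<close>.
\<close>

datatype ('a, 'c) step = Instr | Visit 'a | Call 'c

datatype 'a iteration = Iteration (steps: "('a, 'a iteration) step list")

definition children :: "'a iteration \<Rightarrow> 'a iteration set" where
  "children X = {Y. Call Y \<in> set (steps X)}"

text \<open>The set \<open>X'\<close>.\<close>

definition direct_visits :: "'a iteration \<Rightarrow> 'a set" where
  "direct_visits X = {x. Visit x \<in> set (steps X)}"

text \<open>\<open>T(X)\<close>: the instructions of the iteration itself, without those of its recursive calls.\<close>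

definition own_time :: "'a iteration \<Rightarrow> nat" where
  "own_time X = length (filter (\<lambda>s. s = Instr) (steps X))"

text \<open>A run is given by its root iteration \<open>R\<close>; its iterations are \<open>R\<close> and all descendants.\<close>

inductive_set iterations :: "'a iteration \<Rightarrow> 'a iteration set" for R where
  root: "R \<in> iterations R"
| child: "X \<in> iterations R \<Longrightarrow> Y \<in> children X \<Longrightarrow> Y \<in> iterations R"

text \<open>
  The run as a flat sequence over time: \<open>None\<close> is one executed instruction, \<open>Some x\<close> is the
  visit of \<open>x\<close>.
\<close>

fun trace :: "'a iteration \<Rightarrow> 'a option list" where
  "trace (Iteration ss) = concat (map (\<lambda>s. case s of
      Instr \<Rightarrow> [None] | Visit x \<Rightarrow> [Some x] | Call Y \<Rightarrow> trace Y) ss)"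

definition visit_order :: "'a iteration \<Rightarrow> 'a list" where
  "visit_order X = map the (filter (\<lambda>e. e \<noteq> None) (trace X))"

text \<open>The label of an iteration: everything visited by it or by one of its descendants.\<close>

definition label :: "'a iteration \<Rightarrow> 'a set" where
  "label X = set (visit_order X)"

text \<open>
  Every element of \<open>S\<close> is visited exactly once, and every recursive call has a nonempty label.
  Distinctness of the visits makes the labels of the calls of \<open>X\<close> and \<open>direct_visits X\<close> a
  partition of \<open>label X\<close>. It also makes different nodes of the recursion tree different as
  values of type \<open>'a iteration\<close>, so that functions and sums over values are functions and sums
  over nodes, even when several nodes on a path carry the same label.
\<close>

definition enumerates :: "'a iteration \<Rightarrow> 'a set \<Rightarrow> bool" where
  "enumerates R S \<longleftrightarrow> distinct (visit_order R) \<and> label R = S \<and>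
     (\<forall>X\<in>iterations R. \<forall>Y\<in>children X. label Y \<noteq> {})"

definition potential_function :: "'a iteration \<Rightarrow> ('a iteration \<Rightarrow> real) \<Rightarrow> bool" where
  "potential_function R \<Phi> \<longleftrightarrow> (\<forall>X\<in>iterations R. \<Phi> X > 0)"

definition pyramid_condition ::
    "real \<Rightarrow> 'a iteration \<Rightarrow> ('a iteration \<Rightarrow> real) \<Rightarrow> real \<Rightarrow> bool" where
  "pyramid_condition \<mu> R \<Phi> Tstar \<longleftrightarrow> (\<forall>X\<in>iterations R.
     (\<Sum>Y\<in>children X. \<Phi> Y) + \<mu> * real (card (direct_visits X)) - \<Phi> X
       \<ge> real (own_time X) / Tstar)"

definition root_leaf_paths :: "'a iteration \<Rightarrow> 'a iteration list set" where
  "root_leaf_paths R = {p. p \<noteq> [] \<and> hd p = R \<and> children (last p) = {} \<and>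
     successively (\<lambda>X Y. Y \<in> children X) p}"

text \<open>
  The number of instructions executed until the \<open>k\<close>-th visit has happened; the total number of
  instructions if there are fewer than \<open>k\<close> visits.
\<close>

fun time_until :: "nat \<Rightarrow> 'a option list \<Rightarrow> nat" where
  "time_until 0 es = 0"
| "time_until (Suc k) [] = 0"
| "time_until (Suc k) (None # es) = Suc (time_until (Suc k) es)"
| "time_until (Suc k) (Some x # es) = time_until k es"

definition enumeration_time :: "'a iteration \<Rightarrow> nat \<Rightarrow> nat" where
  "enumeration_time R k = time_until k (trace R)"

end

theory Submission
  imports Defs
begin

text \<open>
  Adding the Pyramid condition over a whole subtree makes the potentials of all non-root nodes
  cancel, so a finished call that made \<open>v\<close> visits took at most \<open>\<mu> v T\<^sup>*\<close> instructions. At the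
  moment of the \<open>k\<close>-th visit the calls in progress lie on one path from the root, and their own
  instructions number at most \<open>\<Delta>\<close>; everything else was executed inside finished calls, which
  together made at most \<open>k\<close> visits. Hence the time is at most \<open>\<mu> k T\<^sup>* + \<Delta>\<close>.
\<close>

abbreviation instr_count :: "'a option list \<Rightarrow> nat" where
  "instr_count es \<equiv> count_list es None"

abbreviation visit_count :: "'a option list \<Rightarrow> nat" where
  "visit_count es \<equiv> length (filter (\<lambda>e. e \<noteq> None) es)"

abbreviation steps_trace :: "('a, 'a iteration) step list \<Rightarrow> 'a option list" where
  "steps_trace ss \<equiv> concat (map (\<lambda>s. case s of
      Instr \<Rightarrow> [None] | Visit x \<Rightarrow> [Some x] | Call Y \<Rightarrow> trace Y) ss)"

lemma iteration_children_induct [case_names Iteration]: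
  assumes "\<And>X. (\<And>Y. Y \<in> children X \<Longrightarrow> P Y) \<Longrightarrow> P X"
  shows "P X"
proof (induction X)
  case (Iteration ss)
  show ?case
    by (rule assms, rule Iteration) (auto simp: children_def)
qed

lemma trace_steps: "trace X = steps_trace (steps X)"
  by (cases X) simp

lemma finite_calls: "finite {Y. Call Y \<in> set ss}"
proof -
  have "{Y. Call Y \<in> set ss} = Call -` set ss" by auto
  then show ?thesis by (simp add: finite_vimageI inj_def)
qed

lemma finite_visits: "finite {x. Visit x \<in> set ss}"
proof -
  have "{x. Visit x \<in> set ss} = Visit -` set ss" by auto
  then show ?thesis by (simp add: finite_vimageI inj_def)
qed

lemma iterations_child_subset:
  assumes "Y \<in> children X"
  shows "iterations Y \<subseteq> iterations X"
proof
  fix Z assume "Z \<in> iterations Y"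
  then show "Z \<in> iterations X"
    by induction (use assms in \<open>auto intro: iterations.intros\<close>)
qed

lemma potential_function_child:
  "potential_function X \<Phi> \<Longrightarrow> Y \<in> children X \<Longrightarrow> potential_function Y \<Phi>"
  using iterations_child_subset unfolding potential_function_def by blast

lemma pyramid_condition_child:
  "pyramid_condition \<mu> X \<Phi> T \<Longrightarrow> Y \<in> children X \<Longrightarrow> pyramid_condition \<mu> Y \<Phi> T"
  using iterations_child_subset unfolding pyramid_condition_def by blast

text \<open>At \<open>k = visit_count es\<close> the clock stops inside \<open>es\<close>, so
  instructions after the last visit of \<open>es\<close> do not count; hence the comparison is
  \<open>\<le>\<close> and not \<open><\<close>.\<close>

lemma time_until_append:
  "time_until k (es @ fs) =
     (if k \<le> visit_count es then time_until k es
      else instr_count es + time_until (k - visit_count es) fs)"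
  by (induction k es rule: time_until.induct) auto

text \<open>The inductive step of the cancellation, for any step list so that list induction
  applies; it is used with \<open>a = \<mu> * T\<close>. Each call trades its potential for its
  visits. Repeated steps collapse in the sets on the left, which can only make that side smaller,
  hence an inequality.\<close>

lemma steps_instr_count_le:
  fixes a T :: real
  assumes "a \<ge> 0" "T \<ge> 0"
    and "\<And>Y. Call Y \<in> set ss \<Longrightarrow> \<Phi> Y \<ge> 0"
    and "\<And>Y. Call Y \<in> set ss \<Longrightarrow>
           real (instr_count (trace Y)) + T * \<Phi> Y \<le> a * real (visit_count (trace Y))"
  shows "real (instr_count (steps_trace ss))
           + T * (\<Sum>Y | Call Y \<in> set ss. \<Phi> Y) + a * real (card {x. Visit x \<in> set ss})
         \<le> real (length (filter (\<lambda>s. s = Instr) ss)) + a * real (visit_count (steps_trace ss))"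
  using assms(3,4)
proof (induction ss)
  case Nil
  then show ?case by simp
next
  case (Cons s ss)
  note IH = Cons.IH[OF Cons.prems]
  show ?case
  proof (cases s)
    case Instr
    then show ?thesis using IH by simp
  next
    case (Visit x)
    have "{y. y = x \<or> Visit y \<in> set ss} = insert x {y. Visit y \<in> set ss}" by auto
    then have "card {y. y = x \<or> Visit y \<in> set ss} \<le> Suc (card {y. Visit y \<in> set ss})"
      by (simp add: card_insert_if finite_visits)
    then have "a * real (card {y. y = x \<or> Visit y \<in> set ss})
        \<le> a * (1 + real (card {y. Visit y \<in> set ss}))"
      by (intro mult_left_mono) (use \<open>a \<ge> 0\<close> in auto)
    then show ?thesis using IH Visit by (simp add: algebra_simps)
  next
    case (Call Z)
    have "{Y. Y = Z \<or> Call Y \<in> set ss} = insert Z {Y. Call Y \<in> set ss}" by auto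
    then have "(\<Sum>Y | Y = Z \<or> Call Y \<in> set ss. \<Phi> Y) \<le> \<Phi> Z + (\<Sum>Y | Call Y \<in> set ss. \<Phi> Y)"
      using Cons.prems(1)[of Z] Call by (simp add: sum.insert_if finite_calls)
    then have "T * (\<Sum>Y | Y = Z \<or> Call Y \<in> set ss. \<Phi> Y)
        \<le> T * (\<Phi> Z + (\<Sum>Y | Call Y \<in> set ss. \<Phi> Y))"
      using \<open>T \<ge> 0\<close> by (rule mult_left_mono)
    then show ?thesis using IH Call Cons.prems(2)[of Z] by (simp add: algebra_simps)
  qed
qed

text \<open>The term \<open>T * \<Phi> X\<close> strengthens the induction: scaled by
  \<open>T\<close>, the Pyramid condition charges part of the work of \<open>X\<close> to the
  potentials of its children, and exactly these terms are supplied by the induction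
  hypotheses.\<close>

lemma instr_count_trace_le:
  assumes "\<mu> \<ge> 0" "T > 0" "potential_function X \<Phi>" "pyramid_condition \<mu> X \<Phi> T"
  shows "real (instr_count (trace X)) + T * \<Phi> X \<le> \<mu> * T * real (visit_count (trace X))"
  using assms(3,4)
proof (induction X rule: iteration_children_induct)
  case (Iteration X)
  have "real (own_time X) / T
      \<le> (\<Sum>Y\<in>children X. \<Phi> Y) + \<mu> * real (card (direct_visits X)) - \<Phi> X"
    using Iteration.prems(2) iterations.root[of X] unfolding pyramid_condition_def by blast
  then have "real (own_time X) + T * \<Phi> X
      \<le> T * (\<Sum>Y\<in>children X. \<Phi> Y) + \<mu> * T * real (card (direct_visits X))"
    using \<open>T > 0\<close> by (simp add: field_simps)
  moreover have "\<Phi> Y \<ge> 0" if "Y \<in> children X" for Y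
    using Iteration.prems(1) iterations.child[OF iterations.root that]
    unfolding potential_function_def by (blast intro: less_imp_le)
  then have "real (instr_count (trace X)) + T * (\<Sum>Y\<in>children X. \<Phi> Y)
        + \<mu> * T * real (card (direct_visits X))
      \<le> real (own_time X) + \<mu> * T * real (visit_count (trace X))"
    using steps_instr_count_le[of "\<mu> * T" T "steps X" \<Phi>] assms(1,2) Iteration
      potential_function_child[of X \<Phi>] pyramid_condition_child[of \<mu> X \<Phi> T]
    by (simp add: trace_steps[of X] children_def direct_visits_def own_time_def)
  ultimately show ?case by linarith
qed

text \<open>The \<open>k\<close>-th visit falls inside at most one call. Calls before it are
  finished and paid for by their visits, so \<open>d\<close> is spent at most once. The instructions
  of \<open>ss\<close> itself are all charged, even those after the cut.\<close>

lemma time_until_steps_le: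
  fixes a d :: real
  assumes "a \<ge> 0" "d \<ge> 0"
    and "\<And>Y. Call Y \<in> set ss \<Longrightarrow>
           real (instr_count (trace Y)) \<le> a * real (visit_count (trace Y))"
    and "\<And>Y j. Call Y \<in> set ss \<Longrightarrow> real (time_until j (trace Y)) \<le> a * real j + d"
  shows "real (time_until k (steps_trace ss))
         \<le> real (length (filter (\<lambda>s. s = Instr) ss)) + a * real k + d"
  using assms(3,4)
proof (induction ss arbitrary: k)
  case Nil
  then show ?case using assms(1,2) by (cases k) auto
next
  case (Cons s ss)
  note IH = Cons.IH[OF Cons.prems]
  show ?case
  proof (cases k)
    case 0
    then show ?thesis using assms(2) by simp
  next
    case (Suc j)
    show ?thesis
    proof (cases s)
      case Instr
      then show ?thesis using IH[of k] Suc by simp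
    next
      case (Visit x)
      then show ?thesis using IH[of j] Suc assms(1) by (simp add: algebra_simps)
    next
      case (Call Y)
      let ?v = "visit_count (trace Y)"
      show ?thesis
      proof (cases "k \<le> ?v")
        \<comment> \<open>The clock stops inside \<open>Y\<close>, and the steps in
          \<open>ss\<close> contribute nothing.\<close>
        case True
        then show ?thesis
          using Cons.prems(2)[of Y k] Call by (simp add: time_until_append)
      next
        \<comment> \<open>\<open>Y\<close> is finished: its visits use up \<open>a * real ?v\<close>
          of the budget \<open>a * real k\<close>, and the rest goes to \<open>ss\<close>.\<close>
        case False
        then have "a * real ?v + a * real (k - ?v) = a * real k"
          by (simp add: of_nat_diff algebra_simps)
        then show ?thesis
          using False Call Cons.prems(1)[of Y] IH[of "k - ?v"] by (simp add: time_until_append)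
      qed
    qed
  qed
qed

lemma root_leaf_paths_leaf: "children X = {} \<Longrightarrow> [X] \<in> root_leaf_paths X"
  by (simp add: root_leaf_paths_def)

lemma root_leaf_paths_Cons:
  "Y \<in> children X \<Longrightarrow> p \<in> root_leaf_paths Y \<Longrightarrow> X # p \<in> root_leaf_paths X"
  by (auto simp: root_leaf_paths_def successively_Cons)

text \<open>Descending into calls must end at a leaf, as the recursion tree is well-founded. So a
  bound over all root-leaf paths is never vacuous.\<close>

lemma root_leaf_paths_nonempty: "root_leaf_paths X \<noteq> {}"
proof (induction X rule: iteration_children_induct)
  case (Iteration X)
  then show ?case using root_leaf_paths_leaf root_leaf_paths_Cons by blast
qed

lemma own_time_le_path_bound:
  fixes \<Delta> :: real
  assumes "\<And>p. p \<in> root_leaf_paths X \<Longrightarrow> real (\<Sum>Z\<leftarrow>p. own_time Z) \<le> \<Delta>"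
  shows "real (own_time X) \<le> \<Delta>"
proof -
  obtain p where p: "p \<in> root_leaf_paths X" using root_leaf_paths_nonempty by blast
  then obtain q where "p = X # q" by (cases p) (auto simp: root_leaf_paths_def)
  then show ?thesis using assms[OF p] by simp
qed

text \<open>\<open>\<Delta>\<close> varies in the induction: entering a child of \<open>X\<close>
  lowers the path budget by \<open>own_time X\<close>.\<close>

lemma enumeration_time_le:
  assumes "\<mu> \<ge> 0" "T > 0" "potential_function X \<Phi>" "pyramid_condition \<mu> X \<Phi> T"
    and "\<And>p. p \<in> root_leaf_paths X \<Longrightarrow> real (\<Sum>Z\<leftarrow>p. own_time Z) \<le> \<Delta>"
  shows "real (enumeration_time X k) \<le> \<mu> * T * real k + \<Delta>"
  using assms(3-5)
proof (induction X arbitrary: \<Delta> k rule: iteration_children_induct)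
  case (Iteration X)
  \<comment> \<open>The budget left for paths starting at a child, since prepending \<open>X\<close>
    to such a path gives a path from \<open>X\<close>.\<close>
  let ?d = "\<Delta> - real (own_time X)"
  have "?d \<ge> 0"
    using own_time_le_path_bound[OF Iteration.prems(3)] by simp
  moreover have "real (instr_count (trace Y)) \<le> \<mu> * T * real (visit_count (trace Y))"
    if Y: "Y \<in> children X" for Y
  proof -
    have "T * \<Phi> Y \<ge> 0"
      using Iteration.prems(1) iterations.child[OF iterations.root Y] \<open>T > 0\<close>
      unfolding potential_function_def by (simp add: less_imp_le)
    then show ?thesis
      using instr_count_trace_le[OF assms(1,2) potential_function_child[OF Iteration.prems(1) Y]
          pyramid_condition_child[OF Iteration.prems(2) Y]] by linarith
  qed
  moreover have "real (time_until j (trace Y)) \<le> \<mu> * T * real j + ?d"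
    if Y: "Y \<in> children X" for Y j
  proof -
    have "real (\<Sum>Z\<leftarrow>p. own_time Z) \<le> ?d" if "p \<in> root_leaf_paths Y" for p
      using Iteration.prems(3)[OF root_leaf_paths_Cons[OF Y that]] by simp
    then show ?thesis
      using Iteration.IH[OF Y potential_function_child[OF Iteration.prems(1) Y]
          pyramid_condition_child[OF Iteration.prems(2) Y], of ?d j]
      by (simp add: enumeration_time_def)
  qed
  ultimately show ?case
    using time_until_steps_le[of "\<mu> * T" ?d "steps X" k] assms(1,2)
    by (simp add: enumeration_time_def trace_steps[of X] children_def own_time_def)
qed

theorem theorem2p6:
  fixes \<mu> :: real
  assumes "\<mu> > 0"
  shows "\<exists>C>0. \<forall>(S :: 'a set) (R :: 'a iteration) \<Phi> (Tstar :: real) (\<Delta> :: real).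
           finite S \<longrightarrow> enumerates R S \<longrightarrow> Tstar > 0 \<longrightarrow>
           potential_function R \<Phi> \<longrightarrow> pyramid_condition \<mu> R \<Phi> Tstar \<longrightarrow>
           (\<forall>p\<in>root_leaf_paths R. real (\<Sum>X\<leftarrow>p. own_time X) \<le> \<Delta>) \<longrightarrow>
           (\<forall>k. real (enumeration_time R k) \<le> C * (real k * Tstar + \<Delta>))"
\<comment> \<open>The constant must dominate the coefficient \<open>\<mu>\<close> of
  \<open>real k * Tstar\<close> and the coefficient 1 of \<open>\<Delta>\<close>.\<close>
proof (intro exI[of _ "max 1 \<mu>"] conjI allI impI)
  show "max 1 \<mu> > 0" by simp
next
  fix R :: "'a iteration" and \<Phi> and Tstar \<Delta> :: real and k
  assume T: "Tstar > 0" and \<Phi>: "potential_function R \<Phi>" "pyramid_condition \<mu> R \<Phi> Tstar"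
    and \<Delta>: "\<forall>p\<in>root_leaf_paths R. real (\<Sum>X\<leftarrow>p. own_time X) \<le> \<Delta>"
  \<comment> \<open>Enlarging the coefficient of \<open>\<Delta>\<close> below requires
    \<open>\<Delta> \<ge> 0\<close>.\<close>
  have "real (own_time R) \<le> \<Delta>" using own_time_le_path_bound \<Delta> by blast
  then have "\<Delta> \<ge> 0" by linarith
  have "real (enumeration_time R k) \<le> \<mu> * Tstar * real k + \<Delta>"
    using enumeration_time_le[OF less_imp_le[OF assms] T \<Phi>] \<Delta> by blast
  also have "\<dots> = \<mu> * (real k * Tstar) + 1 * \<Delta>" by simp
  also have "\<dots> \<le> max 1 \<mu> * (real k * Tstar) + max 1 \<mu> * \<Delta>"
    using T \<open>\<Delta> \<ge> 0\<close> by (intro add_mono mult_right_mono) auto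
  finally show "real (enumeration_time R k) \<le> max 1 \<mu> * (real k * Tstar + \<Delta>)"
    by (simp add: algebra_simps)
qed

end
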